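(* Let $0<q<1$, $\gamma>-1$, $c>0$ and $n\in\mathbb{N}_0$. Then for all $z\in\mathbb{C}$, $$\mathfrak{L}_n^{(\gamma)}(z,c;q)=\frac{1-q^{c}}{1-q}\int_{0}^{1}(1-qt)_q^{c-1}\,\mathcal{L}_n^{(\gamma)}(zt;q)\,d_qt .$$
   Context: $(b;q)_0=1$, $(b;q)_k=(1-b)(1-bq)\cdots(1-bq^{k-1})$ for $k\ge1$, $(b;q)_\infty=\prod_{k\ge0}(1-bq^k)$. The $q$-Laguerre polynomial (in this normalization) is $$\mathcal{L}_n^{(\gamma)}(z;q)={}_1\phi_1\left[{q^{-n}\atop q^{\gamma+1}};q;-q^{n+\gamma+1}z\right]=\sum_{i=0}^{n}\frac{(q^{-n};q)_i}{(q^{\gamma+1};q)_i(q;q)_i}(-1)^iq^{i(i-1)/2}\bigl(-q^{n+\gamma+1}z\bigr)^i,$$ and the generalized $q$-Laguerre polynomial is $$\mathfrak{L}_n^{(\gamma)}(z,c;q)={}_2\phi_2\left[{q^{-n},\,q \atop q^{\gamma+1},\,q^{c+1}};q;-q^{n+\gamma+1}z\right]=\sum_{i=0}^{n}\frac{(q^{-n};q)_i}{(q^{\gamma+1};q)_i\,(q^{c+1};q)_i}(-1)^iq^{i(i-1)/2}\bigl(-q^{n+\gamma+1}z\bigr)^i .$$ The $q$-power is $(x+y)_q^n=\prod_{j=0}^{n-1}(x+q^jy)$ for $n\in\mathbb{N}$, extended to real exponents in the usual way, so that $(1-qt)_q^{c-1}=\dfrac{(qt;q)_\infty}{(q^{c}t;q)_\infty}$.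 The integral is the Jackson $q$-integral $\int_0^1f(t)\,d_qt=(1-q)\sum_{k=0}^\infty q^kf(q^k)$. *)

theory Defs
  imports "HOL-Analysis.Analysis"
begin

definition qpoch :: "'a::comm_ring_1 \<Rightarrow> 'a \<Rightarrow> nat \<Rightarrow> 'a" where
  "qpoch b q k = (\<Prod>j<k. 1 - b * q ^ j)"

definition qpoch_inf :: "'a::real_normed_field \<Rightarrow> 'a \<Rightarrow> 'a" where
  "qpoch_inf b q = (\<Prod>k. 1 - b * q ^ k)"

(* The basic hypergeometric series r-phi-s, with upper parameters as (r = length as) and lower
   parameters bs (s = length bs), in the Gasper-Rahman normalization. *)
definition basic_hypergeom :: "complex list \<Rightarrow> complex list \<Rightarrow> complex \<Rightarrow> complex \<Rightarrow> complex" where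
  "basic_hypergeom as bs q z =
     (\<Sum>i. (\<Prod>a\<leftarrow>as. qpoch a q i) / ((\<Prod>b\<leftarrow>bs. qpoch b q i) * qpoch q q i)
          * ((-1) ^ i * q ^ (i * (i - 1) div 2)) powi (1 + int (length bs) - int (length as))
          * z ^ i)"

definition q_laguerre :: "real \<Rightarrow> nat \<Rightarrow> real \<Rightarrow> complex \<Rightarrow> complex" where
  "q_laguerre q n \<gamma> z =
     basic_hypergeom [of_real (q powr (- real n))] [of_real (q powr (\<gamma> + 1))] (of_real q)
       (- of_real (q powr (real n + \<gamma> + 1)) * z)"

definition gen_q_laguerre :: "real \<Rightarrow> nat \<Rightarrow> real \<Rightarrow> complex \<Rightarrow> real \<Rightarrow> complex" where
  "gen_q_laguerre q n \<gamma> z c =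
     basic_hypergeom [of_real (q powr (- real n)), of_real q]
       [of_real (q powr (\<gamma> + 1)), of_real (q powr (c + 1))] (of_real q)
       (- of_real (q powr (real n + \<gamma> + 1)) * z)"

(* The q-power of x + y with real exponent \<alpha>, for x > 0.  Lemma q_power_of_nat below shows that
   it extends the finite product for natural exponents. *)
definition q_power :: "real \<Rightarrow> real \<Rightarrow> real \<Rightarrow> real \<Rightarrow> real" where
  "q_power q x y \<alpha> =
     x powr \<alpha> * (qpoch_inf (- (y / x)) q / qpoch_inf (- (q powr \<alpha> * (y / x))) q)"

definition jackson_integrable :: "real \<Rightarrow> (real \<Rightarrow> 'a::real_normed_vector) \<Rightarrow> bool" where
  "jackson_integrable q f \<longleftrightarrow> summable (\<lambda>k. q ^ k *\<^sub>R f (q ^ k))"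

(* The Jackson integral over [0,1]. *)
definition jackson_integral :: "real \<Rightarrow> (real \<Rightarrow> 'a::real_normed_vector) \<Rightarrow> 'a" where
  "jackson_integral q f = (1 - q) *\<^sub>R (\<Sum>k. q ^ k *\<^sub>R f (q ^ k))"


lemma qpoch_terminates:
  assumes "0 < q" "n < i"
  shows "qpoch (complex_of_real (q powr (- real n))) (of_real q) i = 0"
proof -
  have "q powr (- real n) * q ^ n = 1"
    using assms by (simp add: powr_minus powr_realpow)
  then have "1 - complex_of_real (q powr (- real n)) * of_real q ^ n = 0"
    by (metis of_real_1 of_real_mult of_real_power diff_self)
  then show ?thesis
    unfolding qpoch_def using assms(2) by (intro prod_zero) auto
qed

lemma qpoch_q_q_nonzero:
  assumes "0 < q" "q < 1"
  shows "qpoch (complex_of_real q) (of_real q) i \<noteq> 0"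
proof -
  have "1 - complex_of_real q * of_real q ^ j \<noteq> 0" for j
  proof -
    have "q ^ Suc j < 1" using assms by (intro power_Suc_less_one) auto
    then have "1 - q * q ^ j \<noteq> 0" by simp
    then have "complex_of_real (1 - q * q ^ j) \<noteq> 0" by (simp only: of_real_eq_0_iff not_False_eq_True)
    then show ?thesis by simp
  qed
  then show ?thesis unfolding qpoch_def by simp
qed

lemma q_laguerre_eq_sum:
  assumes "0 < q" "q < 1"
  shows "q_laguerre q n \<gamma> z =
    (\<Sum>i\<le>n. qpoch (of_real (q powr (- real n))) (of_real q) i
       / (qpoch (of_real (q powr (\<gamma> + 1))) (of_real q) i * qpoch (of_real q) (of_real q) i)
       * (-1) ^ i * of_real q ^ (i * (i - 1) div 2)
       * (- of_real (q powr (real n + \<gamma> + 1)) * z) ^ i)"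
  unfolding q_laguerre_def basic_hypergeom_def
  by (subst suminf_finite[of "{..n}"])
     (auto simp: qpoch_terminates assms not_le mult.assoc intro!: sum.cong)

lemma gen_q_laguerre_eq_sum:
  assumes "0 < q" "q < 1"
  shows "gen_q_laguerre q n \<gamma> z c =
    (\<Sum>i\<le>n. qpoch (of_real (q powr (- real n))) (of_real q) i
       / (qpoch (of_real (q powr (\<gamma> + 1))) (of_real q) i
          * qpoch (of_real (q powr (c + 1))) (of_real q) i)
       * (-1) ^ i * of_real q ^ (i * (i - 1) div 2)
       * (- of_real (q powr (real n + \<gamma> + 1)) * z) ^ i)"
  unfolding gen_q_laguerre_def basic_hypergeom_def
  by (subst suminf_finite[of "{..n}"])
     (auto simp: qpoch_terminates qpoch_q_q_nonzero assms not_le mult.assoc intro!: sum.cong)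

lemma q_power_one_minus:
  assumes "0 < q"
  shows "q_power q 1 (- (q * t)) (c - 1) = qpoch_inf (q * t) q / qpoch_inf (q powr c * t) q"
proof -
  have "- (q powr (c - 1) * (- (q * t) / 1)) = q powr c * t"
    using assms by (simp add: powr_diff)
  then show ?thesis unfolding q_power_def by (simp only:) simp
qed

lemma convergent_prod_qpoch_inf:
  fixes b q :: real
  assumes "0 < q" "q < 1"
  shows "convergent_prod (\<lambda>k. 1 - b * q ^ k)"
proof -
  have "summable (\<lambda>k. norm ((1 - b * q ^ k) - 1))"
    using assms by (simp add: abs_mult power_abs summable_mult summable_geometric)
  then show ?thesis
    by (intro abs_convergent_prod_imp_convergent_prod summable_imp_abs_convergent_prod)
qed

lemma q_power_of_nat:
  assumes "0 < q" "q < 1" "0 < x" and nz: "\<And>j. x + q ^ j * y \<noteq> 0"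
  shows "q_power q x y (real n) = (\<Prod>j<n. x + q ^ j * y)"
proof -
  define b where "b = - (y / x)"
  have fac: "1 - b * q ^ j = (x + q ^ j * y) / x" for j
    using assms by (simp add: b_def field_simps)
  have nz': "1 - b * q ^ j \<noteq> 0" for j
    using nz[of j] assms by (simp add: fac)
  have split: "qpoch_inf b q = (\<Prod>j<n. 1 - b * q ^ j) * qpoch_inf (q ^ n * b) q"
    using prodinf_split_initial_segment[OF convergent_prod_qpoch_inf[OF assms(1,2)], of n b] nz'
    by (simp add: qpoch_inf_def power_add mult_ac)
  have "qpoch_inf b q \<noteq> 0"
    unfolding qpoch_inf_def
    using prodinf_nonzero[OF convergent_prod_qpoch_inf[OF assms(1,2), of b]] nz' by auto
  then have ne: "qpoch_inf (q ^ n * b) q \<noteq> 0" using split by auto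
  have "q_power q x y (real n) = x ^ n * (qpoch_inf b q / qpoch_inf (q ^ n * b) q)"
    using assms by (simp add: q_power_def b_def powr_realpow)
  also have "\<dots> = x ^ n * (\<Prod>j<n. 1 - b * q ^ j)"
    using ne by (simp add: split)
  also have "\<dots> = (\<Prod>j<n. x + q ^ j * y)"
    using assms by (simp add: fac prod_dividef)
  finally show ?thesis .
qed

end

theory Submission
  imports Defs
begin

text \<open>
  Both sides are polynomials in \<open>z\<close>, so the identity is one about coefficients: integrating
  the \<open>q\<close>-Laguerre polynomial term by term, it says that multiplying its \<open>i\<close>-th coefficient by the
  \<open>i\<close>-th moment of the weight \<open>(1 - qt)\<^sub>q\<^sup>c\<^sup>-\<^sup>1\<close>, normalized by \<open>(1 - q\<^sup>c) / (1 - q)\<close>, trades the factor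
  \<open>(q; q)\<^sub>i\<close> in the denominator for \<open>(q\<^sup>c\<^sup>+\<^sup>1; q)\<^sub>i\<close>.  With \<open>a = q\<^sup>c\<close>, the weight at the node \<open>t = q\<^sup>k\<close>
  is \<open>w\<^sub>k = (q\<^sup>k\<^sup>+\<^sup>1; q)\<^sub>\<infinity> / (a q\<^sup>k; q)\<^sub>\<infinity>\<close>, and the claim becomes the discrete \<open>q\<close>-beta integral
  \<open>\<Sum>\<^sub>k w\<^sub>k q\<^sup>k\<^sup>(\<^sup>i\<^sup>+\<^sup>1\<^sup>) = (q; q)\<^sub>i / (a; q)\<^sub>i\<^sub>+\<^sub>1\<close> (\<open>q_beta_moment_sums\<close>).

  The usual derivation of the moments goes through the \<open>q\<close>-binomial theorem.  Here they follow
  instead from two properties of the weight: the first-order recurrence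
  \<open>(1 - q\<^sup>k\<^sup>+\<^sup>1) w\<^sub>k\<^sub>+\<^sub>1 = (1 - a q\<^sup>k) w\<^sub>k\<close>, and \<open>w\<^sub>k \<longrightarrow> 1\<close>.  The recurrence makes
  \<open>(1 - q\<^sup>k) w\<^sub>k q\<^sup>k\<^sup>m\<close> a discrete antiderivative of a combination of two consecutive moment
  summands (\<open>q_pearson_telescope\<close>), which is integration by parts; so each moment determines the
  next, and the limit of the weight determines the first one.
\<close>

section \<open>Shifted infinite products\<close>

lemma qpoch_Suc: "qpoch b q (Suc k) = qpoch b q k * (1 - b * q ^ k)"
  by (simp add: qpoch_def)

lemma qpoch_Suc_shift: "qpoch b q (Suc k) = (1 - b) * qpoch (b * q) q k"
  by (simp add: qpoch_def prod.lessThan_Suc_shift mult.assoc del: prod.lessThan_Suc)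

lemma qpoch_of_real:
  "qpoch (of_real b :: 'a::{real_algebra_1, comm_ring_1}) (of_real q) k = of_real (qpoch b q k)"
  by (induction k) (simp_all add: qpoch_def)

lemma one_minus_mult_power_pos:
  fixes b q :: real
  assumes "0 < q" "q < 1" "0 < b" "b < 1"
  shows "1 - b * q ^ k > 0"
proof -
  have "b * q ^ k \<le> b * 1"
    using assms by (intro mult_left_mono power_le_one) auto
  then show ?thesis using assms(4) by linarith
qed

lemma qpoch_pos:
  fixes b q :: real
  assumes "0 < q" "q < 1" "0 < b" "b < 1"
  shows "qpoch b q k > 0"
  unfolding qpoch_def by (intro prod_pos ballI one_minus_mult_power_pos assms)

lemma qpoch_inf_nonzero:
  fixes b q :: real
  assumes "0 < q" "q < 1" "0 < b" "b < 1"
  shows "qpoch_inf b q \<noteq> 0"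
  unfolding qpoch_inf_def
  using prodinf_nonzero[OF convergent_prod_qpoch_inf[OF assms(1,2), of b]]
    one_minus_mult_power_pos[OF assms] by (metis less_irrefl)

lemma qpoch_inf_split:
  fixes b q :: real
  assumes "0 < q" "q < 1" "0 < b" "b < 1"
  shows "qpoch_inf b q = qpoch b q k * qpoch_inf (b * q ^ k) q"
proof -
  have "1 - b * q ^ j \<noteq> 0" for j
    using one_minus_mult_power_pos[OF assms, of j] by simp
  then show ?thesis
    using prodinf_split_initial_segment[OF convergent_prod_qpoch_inf[OF assms(1,2)], of k b]
    by (simp add: qpoch_inf_def qpoch_def power_add mult_ac)
qed

lemma qpoch_inf_shift_Suc:
  fixes b q :: real
  assumes "0 < q" "q < 1" "0 < b" "b < 1"
  shows "qpoch_inf (b * q ^ k) q = (1 - b * q ^ k) * qpoch_inf (b * q ^ Suc k) q"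
  using qpoch_inf_split[OF assms, of k] qpoch_inf_split[OF assms, of "Suc k"]
    qpoch_pos[OF assms, of k]
  by (simp add: qpoch_Suc)

lemma qpoch_inf_shift_nonzero:
  fixes b q :: real
  assumes "0 < q" "q < 1" "0 < b" "b < 1"
  shows "qpoch_inf (b * q ^ k) q \<noteq> 0"
  using qpoch_inf_split[OF assms, of k] qpoch_inf_nonzero[OF assms] by auto

text \<open>The shifted products are the tails of a convergent product with nonzero value.\<close>

lemma qpoch_inf_shift_tendsto:
  fixes b q :: real
  assumes "0 < q" "q < 1" "0 < b" "b < 1"
  shows "(\<lambda>k. qpoch_inf (b * q ^ k) q) \<longlonglongrightarrow> 1"
proof -
  have "(\<lambda>k. \<Prod>j\<le>k. 1 - b * q ^ j) \<longlonglongrightarrow> qpoch_inf b q"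
    unfolding qpoch_inf_def by (rule convergent_prod_LIMSEQ[OF convergent_prod_qpoch_inf[OF assms(1,2)]])
  then have "(\<lambda>k. qpoch b q (Suc k)) \<longlonglongrightarrow> qpoch_inf b q"
    by (simp add: qpoch_def lessThan_Suc_atMost)
  then have "(\<lambda>k. qpoch b q k) \<longlonglongrightarrow> qpoch_inf b q"
    by (rule LIMSEQ_imp_Suc)
  then have "(\<lambda>k. qpoch_inf b q / qpoch b q k) \<longlonglongrightarrow> qpoch_inf b q / qpoch_inf b q"
    using qpoch_inf_nonzero[OF assms] by (intro tendsto_divide tendsto_const)
  moreover have "qpoch_inf b q / qpoch b q k = qpoch_inf (b * q ^ k) q" for k
    using qpoch_inf_split[OF assms, of k] qpoch_pos[OF assms, of k] by simp
  ultimately show ?thesis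
    using qpoch_inf_nonzero[OF assms] by simp
qed

section \<open>Moments of the q-beta weight\<close>

text \<open>The value of the weight \<open>(1 - qt)\<^sub>q\<^sup>c\<^sup>-\<^sup>1\<close> at \<open>t = q\<^sup>k\<close>, where \<open>a = q\<^sup>c\<close>.\<close>

definition q_beta_weight :: "real \<Rightarrow> real \<Rightarrow> nat \<Rightarrow> real" where
  "q_beta_weight q a k = qpoch_inf (q * q ^ k) q / qpoch_inf (a * q ^ k) q"

lemma q_beta_weight_Suc:
  assumes "0 < q" "q < 1" "0 < a" "a < 1"
  shows "(1 - q ^ Suc k) * q_beta_weight q a (Suc k) = (1 - a * q ^ k) * q_beta_weight q a k"
  using qpoch_inf_shift_Suc[of q q k] qpoch_inf_shift_Suc[of q a k]
    qpoch_inf_shift_nonzero[of q a k] assms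
  by (simp add: q_beta_weight_def)

lemma q_beta_weight_tendsto:
  assumes "0 < q" "q < 1" "0 < a" "a < 1"
  shows "q_beta_weight q a \<longlonglongrightarrow> 1"
proof -
  have "(\<lambda>k. qpoch_inf (q * q ^ k) q / qpoch_inf (a * q ^ k) q) \<longlonglongrightarrow> 1 / 1"
    using assms by (intro tendsto_divide qpoch_inf_shift_tendsto) auto
  then show ?thesis by (simp add: q_beta_weight_def[abs_def])
qed

text \<open>
  Discrete integration by parts.  The recurrence for \<open>w\<close> is the discrete analogue of Pearson's
  equation \<open>(\<sigma> w)' = \<tau> w\<close>, with \<open>\<sigma>(t) = 1 - t\<close> vanishing at the endpoint \<open>t = 1\<close>.  The
  difference of \<open>(1 - q\<^sup>k) w\<^sub>k q\<^sup>k\<^sup>m\<close> is therefore again \<open>w\<close> times a polynomial in \<open>q\<^sup>k\<close>, and the only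
  boundary term comes from \<open>k \<longrightarrow> \<infinity>\<close>.
\<close>

lemma q_pearson_telescope:
  fixes q a L :: real and w :: "nat \<Rightarrow> real"
  assumes rec: "\<And>k. (1 - q ^ Suc k) * w (Suc k) = (1 - a * q ^ k) * w k"
    and lim: "(\<lambda>k. (1 - q ^ k) * w k * (q ^ k) ^ m) \<longlonglongrightarrow> L"
  shows "(\<lambda>k. (1 - a * q ^ m) * (w k * (q ^ k) ^ Suc m) - (1 - q ^ m) * (w k * (q ^ k) ^ m))
           sums L"
proof -
  let ?T = "\<lambda>k. (1 - q ^ k) * w k * (q ^ k) ^ m"
  have "(\<lambda>k. ?T (Suc k) - ?T k) sums (L - ?T 0)"
    by (rule telescope_sums[OF lim])
  moreover have "?T (Suc k) - ?T k =
      (1 - a * q ^ m) * (w k * (q ^ k) ^ Suc m) - (1 - q ^ m) * (w k * (q ^ k) ^ m)" for k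
  proof -
    have "?T (Suc k) = (1 - a * q ^ k) * w k * (q ^ m * (q ^ k) ^ m)"
      by (simp only: rec) (simp add: power_mult_distrib)
    then show ?thesis by (simp add: algebra_simps)
  qed
  ultimately show ?thesis by simp
qed

text \<open>
  The \<open>q\<close>-beta integral.  In the telescoping identity the boundary term is \<open>lim w\<^sub>k = 1\<close> for
  \<open>m = 0\<close>, where the lower moment drops out since \<open>1 - q\<^sup>0 = 0\<close>; it vanishes for
  \<open>m > 0\<close>, which leaves a two-term recurrence.  Convergence of each moment series comes from
  that of the previous one.
\<close>

lemma q_beta_moment_sums:
  assumes q: "0 < q" "q < 1" and a: "0 < a" "a < 1"
  shows "(\<lambda>k. q_beta_weight q a k * (q ^ k) ^ Suc i) sums (qpoch q q i / qpoch a q (Suc i))"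
proof (induction i)
  case 0
  have q0: "(\<lambda>k. q ^ k) \<longlonglongrightarrow> 0"
    using q by (intro LIMSEQ_power_zero) simp
  have "(\<lambda>k. (1 - q ^ k) * q_beta_weight q a k * (q ^ k) ^ 0) \<longlonglongrightarrow> (1 - 0) * 1 * 1"
    unfolding power_0
    by (intro tendsto_mult tendsto_diff tendsto_const q0 q_beta_weight_tendsto[OF q a])
  from q_pearson_telescope[OF q_beta_weight_Suc[OF q a] this]
  have "(\<lambda>k. (1 - a) * (q_beta_weight q a k * q ^ k)) sums 1"
    by simp
  then have "(\<lambda>k. (1 - a) * (q_beta_weight q a k * q ^ k) / (1 - a)) sums (1 / (1 - a))"
    by (rule sums_divide)
  then show ?case using a by (simp add: qpoch_def)
next
  case (Suc i)
  let ?w = "q_beta_weight q a" and ?m = "Suc i"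
  have nz: "1 - a * q ^ ?m \<noteq> 0"
    using one_minus_mult_power_pos[OF q a, of ?m] by simp
  have q0: "(\<lambda>k. q ^ k) \<longlonglongrightarrow> 0"
    using q by (intro LIMSEQ_power_zero) simp
  have "(\<lambda>k. (1 - q ^ k) * ?w k * (q ^ k) ^ ?m) \<longlonglongrightarrow> (1 - 0) * 1 * 0 ^ ?m"
    by (intro tendsto_mult tendsto_power tendsto_diff tendsto_const q0
        q_beta_weight_tendsto[OF q a])
  from q_pearson_telescope[OF q_beta_weight_Suc[OF q a] this]
  have "(\<lambda>k. (1 - a * q ^ ?m) * (?w k * (q ^ k) ^ Suc ?m) - (1 - q ^ ?m) * (?w k * (q ^ k) ^ ?m))
          sums 0"
    by simp
  from sums_add[OF this sums_mult[OF Suc.IH, of "1 - q ^ ?m"]]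
  have "(\<lambda>k. (1 - a * q ^ ?m) * (?w k * (q ^ k) ^ Suc ?m))
          sums ((1 - q ^ ?m) * (qpoch q q i / qpoch a q ?m))"
    by simp
  then have "(\<lambda>k. (1 - a * q ^ ?m) * (?w k * (q ^ k) ^ Suc ?m) / (1 - a * q ^ ?m))
          sums ((1 - q ^ ?m) * (qpoch q q i / qpoch a q ?m) / (1 - a * q ^ ?m))"
    by (rule sums_divide)
  moreover have "(1 - q ^ ?m) * (qpoch q q i / qpoch a q ?m) / (1 - a * q ^ ?m)
      = qpoch q q ?m / qpoch a q (Suc ?m)"
    by (simp add: qpoch_Suc mult_ac)
  moreover have "(1 - a * q ^ ?m) * (?w k * (q ^ k) ^ Suc ?m) / (1 - a * q ^ ?m)
      = ?w k * (q ^ k) ^ Suc ?m" for k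
    using nz by (rule nonzero_mult_div_cancel_left)
  ultimately show ?case by (simp only:)
qed

section \<open>Integrating polynomials against the weight\<close>

lemma q_beta_polynomial_sums:
  fixes C :: "nat \<Rightarrow> complex"
  assumes "0 < q" "q < 1" "0 < a" "a < 1"
  shows "(\<lambda>k. q ^ k *\<^sub>R (of_real (q_beta_weight q a k) * (\<Sum>i\<le>n. C i * of_real (q ^ k) ^ i)))
           sums (\<Sum>i\<le>n. C i * of_real (qpoch q q i / qpoch a q (Suc i)))"
proof -
  have "(\<lambda>k. \<Sum>i\<le>n. C i * of_real (q_beta_weight q a k * (q ^ k) ^ Suc i))
          sums (\<Sum>i\<le>n. C i * of_real (qpoch q q i / qpoch a q (Suc i)))"
    by (intro sums_sum sums_mult sums_of_real q_beta_moment_sums assms)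
  moreover have "(\<Sum>i\<le>n. C i * of_real (q_beta_weight q a k * (q ^ k) ^ Suc i))
      = q ^ k *\<^sub>R (of_real (q_beta_weight q a k) * (\<Sum>i\<le>n. C i * of_real (q ^ k) ^ i))" for k
    by (simp add: scaleR_conv_of_real sum_distrib_left mult_ac)
  ultimately show ?thesis by simp
qed

theorem proposition2p2:
  fixes q \<gamma> c :: real and n :: nat and z :: complex
  assumes "0 < q" and "q < 1" and "\<gamma> > -1" and "c > 0"
  shows "jackson_integrable q
           (\<lambda>t. of_real (q_power q 1 (- (q * t)) (c - 1)) * q_laguerre q n \<gamma> (z * of_real t))
       \<and> gen_q_laguerre q n \<gamma> z c =
           of_real ((1 - q powr c) / (1 - q)) *
           jackson_integral q
             (\<lambda>t. of_real (q_power q 1 (- (q * t)) (c - 1)) * q_laguerre q n \<gamma> (z * of_real t))"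
proof -
  define a where "a = q powr c"
  have a: "0 < a" "a < 1"
    using assms powr_less_mono'[of q 0 c] by (auto simp: a_def)
  have aq: "q powr (c + 1) = a * q"
    using assms by (simp add: a_def powr_add)
  \<comment> \<open>the two polynomials have \<open>i\<close>-th terms \<open>D i / (q\<^sup>c\<^sup>+\<^sup>1; q)\<^sub>i\<close> and \<open>D i / (q; q)\<^sub>i\<close>\<close>
  define D where "D i = qpoch (of_real (q powr (- real n))) (of_real q) i
       / qpoch (of_real (q powr (\<gamma> + 1))) (of_real q) i
       * (-1) ^ i * of_real q ^ (i * (i - 1) div 2)
       * (- of_real (q powr (real n + \<gamma> + 1)) * z) ^ i" for i :: nat
  define C where "C i = D i / of_real (qpoch q q i)" for i
  let ?f = "\<lambda>t. of_real (q_power q 1 (- (q * t)) (c - 1)) * q_laguerre q n \<gamma> (z * of_real t)"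
  let ?S = "\<Sum>i\<le>n. C i * of_real (qpoch q q i / qpoch a q (Suc i))"
  have "?f (q ^ k) = of_real (q_beta_weight q a k) * (\<Sum>i\<le>n. C i * of_real (q ^ k) ^ i)" for k
  proof -
    let ?P = "of_real (q powr (real n + \<gamma> + 1)) :: complex"
    have arg: "- ?P * (z * of_real (q ^ k)) = (- ?P * z) * of_real (q ^ k)"
      by simp
    have "q_laguerre q n \<gamma> (z * of_real (q ^ k)) = (\<Sum>i\<le>n. C i * of_real (q ^ k) ^ i)"
      unfolding q_laguerre_eq_sum[OF assms(1,2)] arg power_mult_distrib[of "- ?P * z"]
      by (simp add: C_def D_def qpoch_of_real mult_ac)
    then show ?thesis
      using assms by (simp add: q_power_one_minus q_beta_weight_def a_def)
  qed
  then have sums: "(\<lambda>k. q ^ k *\<^sub>R ?f (q ^ k)) sums ?S"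
    using q_beta_polynomial_sums[OF assms(1,2) a, of C n] by simp
  have "gen_q_laguerre q n \<gamma> z c = (\<Sum>i\<le>n. D i / of_real (qpoch (a * q) q i))"
    using assms by (simp add: gen_q_laguerre_eq_sum D_def aq qpoch_of_real flip: of_real_mult)
  also have "\<dots> = (\<Sum>i\<le>n. of_real (1 - a) * (C i * of_real (qpoch q q i / qpoch a q (Suc i))))"
  proof (intro sum.cong refl)
    fix i
    have "of_real (qpoch q q i) \<noteq> (0 :: complex)" "of_real (1 - a) \<noteq> (0 :: complex)"
      using qpoch_pos[OF assms(1,2,1,2), of i] a by (simp_all only: of_real_eq_0_iff)
    then show "D i / of_real (qpoch (a * q) q i)
        = of_real (1 - a) * (C i * of_real (qpoch q q i / qpoch a q (Suc i)))"
      unfolding C_def qpoch_Suc_shift of_real_mult of_real_divide by simp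
  qed
  also have "\<dots> = of_real (1 - a) * ?S"
    by (rule sum_distrib_left[symmetric])
  also have "\<dots> = of_real ((1 - a) / (1 - q)) * jackson_integral q ?f"
  proof -
    have "jackson_integral q ?f = of_real (1 - q) * ?S"
      unfolding jackson_integral_def sums_unique[OF sums, symmetric]
      by (rule scaleR_conv_of_real)
    moreover have "complex_of_real (1 - a) = of_real ((1 - a) / (1 - q)) * of_real (1 - q)"
      using assms(2) unfolding of_real_mult[symmetric] by simp
    ultimately show ?thesis by (simp only: mult.assoc)
  qed
  finally show ?thesis
    using sums_summable[OF sums] unfolding jackson_integrable_def a_def by blast
qed

end
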